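(* Let $\mathcal{Z}^w\subseteq\mathbb{R}^{d_m}$, let $\mathcal{A}$ be an action space, let $\hat Q_C^+:\mathcal{Z}^w\times\mathcal{A}\to\mathbb{R}$ be a (pessimistic) cost critic and $f_z:\mathcal{Z}^w\times\mathcal{A}\to\mathcal{Z}^w$ a latent transition mean. For each episode $k$ of length $T_k$, consider a trajectory with latent states $Z_t^{w,k}\in\mathcal{Z}^w$ and remaining budgets $B_t^k$ ($0\le t\le T_k$), selected actions $A_t^k\in\mathcal{A}$ and realized costs $C_{t+1}^k$ ($0\le t\le T_k-1$), and finite candidate action sets $\mathcal{A}_{t,k}^{\mathrm{cand}}$, with $B_{t+1}^k=B_t^k-C_{t+1}^k$. Assume: (1) (Approximate latent dynamics) $\|f_z(Z_t^{w,k},A_t^k)-Z_{t+1}^{w,k}\|_2\le\varepsilon_{\mathrm{pred}}$ for all episodes $k$ and timesteps $t$ along the trajectories considered. (2) (Latent Q-regularity) There is $L_Q>0$ such that for every action $A$ in the candidate action sets and all $Z,Z'\in\mathcal{Z}^w$, $|\hat Q_C^+(Z,A)-\hat Q_C^+(Z',A)|\le L_Q\|Z-Z'\|_2$. Then, for every episode $k$, every $t\in\{0,\dots,T_k-1\}$ and any selected action $A_t^k$, $$b_{V,t+1}^k(Z_{t+1}^{w,k},B_{t+1}^k)\;\ge\; b_{Q,t}^k(Z_t^{w,k},B_t^k,A_t^k)-\Delta_{\mathrm{bell},t}^{+,k}-L_Q\,\varepsilon_{\mathrm{pred}},$$ where $b_V$, $b_Q$ are the state and state-action barriers and $\Delta_{\mathrm{bell},t}^{+,k}$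 is the Bellman upper-bound error, as defined in the context.
   Context: Episodes are indexed by $k$, timesteps within episode $k$ by $t$, and $T_k$ is the terminal timestep of episode $k$. $Z_t^{w,k}\in\mathcal{Z}^w\subseteq\mathbb{R}^{d_m}$ is the world-projected latent state at time $t$ of episode $k$; $A_t^k$ is the selected (executed) action; $C_{t+1}^k$ is the realized cost of that step, valued in $\mathbb{R}^+$. The remaining cost budget starts at $B_0^k=\delta$ and satisfies $B_t^k=\delta-\sum_{i=1}^t C_i^k$, i.e. $B_{t+1}^k=B_t^k-C_{t+1}^k$ (it may become negative). The critic is $\hat Q_C^+(Z,A)=\max_{i\in\{1,\dots,M\}}\hat Q_{C,i}(Z,A)$ for an ensemble of real-valued critics $\hat Q_{C,1},\dots,\hat Q_{C,M}$ on $\mathcal{Z}^w\times\mathcal{A}$. $f_z(Z,A)$ is the mean of a learned latent transition model. $\mathcal{A}_{t,k}^{\mathrm{cand}}\subseteq\mathcal{A}$ is the finite nonempty candidate set at decision time $t$ of episode $k$; candidate sets are regarded as fixed (statements are conditional on the realized candidate sets). Candidate-set cost value: for $Z\in\mathcal{Z}^w$ and $t<T_k$, $\hat V_{C,t}^{+,k}(Z)=\min_{A\in\mathcal{A}_{t,k}^{\mathrm{cand}}}\hat Q_C^+(Z,A)$, with the terminal convention $\hat V_{C,T_k}^{+,k}=0$. State barrier: $b_{V,t}^k(Z,B)=B-\hat V_{C,t}^{+,k}(Z)$. State-action barrier: $b_{Q,t}^k(Z,B,A)=B-\hat Q_C^+(Z,A)$. Bellman upper-bound error, with $[x]_+=\max\{x,0\}$: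 $$\Delta_{\mathrm{bell},t}^{+,k}=\Big[C_{t+1}^k+\hat V_{C,t+1}^{+,k}\big(f_z(Z_t^{w,k},A_t^k)\big)-\hat Q_C^+(Z_t^{w,k},A_t^k)\Big]_+.$$ *)

theory Defs
  imports "HOL-Analysis.Analysis"
begin

definition pessimistic_critic :: "nat \<Rightarrow> (nat \<Rightarrow> 'z \<Rightarrow> 'a \<Rightarrow> real) \<Rightarrow> 'z \<Rightarrow> 'a \<Rightarrow> real" where
  "pessimistic_critic M Q z a = Max ((\<lambda>i. Q i z a) ` {1..M})"

text \<open>
  The remaining definitions concern a single episode: \<open>cand t\<close> is the candidate set at
  time \<open>t\<close>, \<open>N\<close> is the terminal timestep, and \<open>q\<close> is the (aggregated) critic.
  The value at the terminal timestep is \<open>0\<close> by convention; times beyond \<open>N\<close>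
  never matter.
\<close>

definition cost_value ::
  "('z \<Rightarrow> 'a \<Rightarrow> real) \<Rightarrow> (nat \<Rightarrow> 'a set) \<Rightarrow> nat \<Rightarrow> nat \<Rightarrow> 'z \<Rightarrow> real" where
  "cost_value q cand N t z = (if t < N then Min ((\<lambda>a. q z a) ` cand t) else 0)"

definition state_barrier ::
  "('z \<Rightarrow> 'a \<Rightarrow> real) \<Rightarrow> (nat \<Rightarrow> 'a set) \<Rightarrow> nat \<Rightarrow> nat \<Rightarrow> 'z \<Rightarrow> real \<Rightarrow> real" where
  "state_barrier q cand N t z b = b - cost_value q cand N t z"

text \<open>The state-action barrier does not depend on time beyond its arguments.\<close>

definition state_action_barrier ::
  "('z \<Rightarrow> 'a \<Rightarrow> real) \<Rightarrow> 'z \<Rightarrow> real \<Rightarrow> 'a \<Rightarrow> real" where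
  "state_action_barrier q z b a = b - q z a"

text \<open>\<open>C (t + 1)\<close> is the cost realized by the action \<open>A t\<close>.\<close>

definition bellman_error ::
  "('z \<Rightarrow> 'a \<Rightarrow> real) \<Rightarrow> ('z \<Rightarrow> 'a \<Rightarrow> 'z) \<Rightarrow> (nat \<Rightarrow> 'a set) \<Rightarrow> nat
    \<Rightarrow> (nat \<Rightarrow> 'z) \<Rightarrow> (nat \<Rightarrow> 'a) \<Rightarrow> (nat \<Rightarrow> real) \<Rightarrow> nat \<Rightarrow> real" where
  "bellman_error q f cand N Z A C t =
     max (C (t + 1) + cost_value q cand N (t + 1) (f (Z t) (A t)) - q (Z t) (A t)) 0"

end

theory Submission
  imports Defs
begin

text \<open>
  Advancing the budget subtracts exactly the realized cost, so the one-step loss of the barrier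
  is the Bellman error, measured at the predicted next state, plus the change of the candidate
  value between the predicted and the actual next state. A minimum of \<open>L\<close>-Lipschitz functions over
  a fixed finite set is \<open>L\<close>-Lipschitz, so the latter is at most \<open>L * \<epsilon>\<close>.
\<close>

text \<open>A minimizer of \<open>h\<close> is an admissible competitor in the minimum of
  \<open>g\<close>, where it costs at most \<open>d\<close> more.\<close>

lemma Min_image_le_Min_image_add:
  fixes g h :: "'a \<Rightarrow> 'b :: linordered_ab_group_add"
  assumes "finite S" "S \<noteq> {}" and le: "\<And>a. a \<in> S \<Longrightarrow> g a \<le> h a + d"
  shows "Min (g ` S) \<le> Min (h ` S) + d"
proof -
  have "Min (h ` S) \<in> h ` S"
    using assms(1,2) by (intro Min_in) auto
  then obtain a where a: "a \<in> S" "Min (h ` S) = h a"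
    by auto
  have "Min (g ` S) \<le> g a"
    using assms(1) a(1) by simp
  then show ?thesis
    using le[OF a(1)] a(2) by simp
qed

text \<open>Before \<open>N\<close> the bound for each candidate passes to the minimum; from
  \<open>N\<close> on both values are \<open>0\<close> and \<open>0 \<le> L\<close> suffices. The
  guards \<open>t < N\<close> let the lemma cover the step into the terminal time as well, and
  \<open>lip\<close> concerns one pair of points only, so regularity restricted to a subset can
  supply it.\<close>

lemma cost_value_lipschitz:
  fixes z z' :: "'z :: real_normed_vector"
  assumes "0 \<le> L"
    and "t < N \<Longrightarrow> finite (cand t) \<and> cand t \<noteq> {}"
    and lip: "\<And>a. t < N \<Longrightarrow> a \<in> cand t \<Longrightarrow> \<bar>q z a - q z' a\<bar> \<le> L * norm (z - z')"
  shows "cost_value q cand N t z \<le> cost_value q cand N t z' + L * norm (z - z')"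
proof (cases "t < N")
  case True
  have "q z a \<le> q z' a + L * norm (z - z')" if "a \<in> cand t" for a
    using lip[OF True that] by linarith
  then show ?thesis
    using True assms(2) by (simp add: cost_value_def Min_image_le_Min_image_add)
next
  case False
  then show ?thesis
    using assms(1) by (simp add: cost_value_def)
qed

theorem theorem1:
  fixes Zw :: "(real ^ 'm) set"
    and Act :: "'a set"
    and M :: nat
    and Q :: "nat \<Rightarrow> real ^ 'm \<Rightarrow> 'a \<Rightarrow> real"
    and f :: "real ^ 'm \<Rightarrow> 'a \<Rightarrow> real ^ 'm"
    and K :: "nat set"
    and T :: "nat \<Rightarrow> nat"
    and Z :: "nat \<Rightarrow> nat \<Rightarrow> real ^ 'm"
    and A :: "nat \<Rightarrow> nat \<Rightarrow> 'a"
    and B C :: "nat \<Rightarrow> nat \<Rightarrow> real"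
    and cand :: "nat \<Rightarrow> nat \<Rightarrow> 'a set"
    and \<delta> \<epsilon> L :: real
  assumes ensemble_size: "M \<ge> 1"
    and latent_transition: "\<forall>z\<in>Zw. \<forall>a\<in>Act. f z a \<in> Zw"
    and latent_states: "\<forall>k\<in>K. \<forall>t\<le>T k. Z k t \<in> Zw"
    and selected_actions: "\<forall>k\<in>K. \<forall>t<T k. A k t \<in> Act"
    and costs: "\<forall>k\<in>K. \<forall>t<T k. C k (t + 1) \<ge> 0"
    and candidates: "\<forall>k\<in>K. \<forall>t<T k. cand k t \<subseteq> Act \<and> finite (cand k t) \<and> cand k t \<noteq> {}"
    and initial_budget: "\<forall>k\<in>K. B k 0 = \<delta>"
    and budget_step: "\<forall>k\<in>K. \<forall>t<T k. B k (t + 1) = B k t - C k (t + 1)"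
    and approx_dynamics: "\<forall>k\<in>K. \<forall>t<T k. norm (f (Z k t) (A k t) - Z k (t + 1)) \<le> \<epsilon>"
    and L_pos: "L > 0"
    and Q_regularity:
      "\<forall>k\<in>K. \<forall>t<T k. \<forall>a\<in>cand k t. \<forall>z\<in>Zw. \<forall>z'\<in>Zw.
         \<bar>pessimistic_critic M Q z a - pessimistic_critic M Q z' a\<bar> \<le> L * norm (z - z')"
  shows "\<forall>k\<in>K. \<forall>t<T k.
    state_barrier (pessimistic_critic M Q) (cand k) (T k) (t + 1) (Z k (t + 1)) (B k (t + 1))
      \<ge> state_action_barrier (pessimistic_critic M Q) (Z k t) (B k t) (A k t)
        - bellman_error (pessimistic_critic M Q) f (cand k) (T k) (Z k) (A k) (C k) t
        - L * \<epsilon>"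
proof (intro ballI allI impI)
  fix k t
  assume k: "k \<in> K" and t: "t < T k"
  let ?q = "pessimistic_critic M Q"
  let ?V = "cost_value ?q (cand k) (T k) (t + 1)"
  let ?y = "f (Z k t) (A k t)"
  \<comment> \<open>\<open>Q_regularity\<close> compares points of \<open>Zw\<close> only, so both
    the predicted and the actual next state must lie there.\<close>
  have y: "?y \<in> Zw" and z: "Z k (t + 1) \<in> Zw"
    using k t latent_states latent_transition selected_actions by auto
  \<comment> \<open>The index \<open>t + 1\<close> may equal \<open>T k\<close>;
    \<open>candidates\<close> and \<open>Q_regularity\<close> are then called on only when
    \<open>t + 1 < T k\<close>.\<close>
  have "?V (Z k (t + 1)) \<le> ?V ?y + L * norm (Z k (t + 1) - ?y)"
    using k y z L_pos candidates Q_regularity by (intro cost_value_lipschitz) auto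
  moreover have "L * norm (Z k (t + 1) - ?y) \<le> L * \<epsilon>"
    using k t L_pos approx_dynamics by (simp add: norm_minus_commute)
  moreover have "B k (t + 1) = B k t - C k (t + 1)"
    using k t budget_step by blast
  ultimately show "state_barrier ?q (cand k) (T k) (t + 1) (Z k (t + 1)) (B k (t + 1))
      \<ge> state_action_barrier ?q (Z k t) (B k t) (A k t)
        - bellman_error ?q f (cand k) (T k) (Z k) (A k) (C k) t - L * \<epsilon>"
    \<comment> \<open>The positive part dominates its argument, so
      \<open>C k (t + 1) + ?V ?y\<close> is at most \<open>?q (Z k t) (A k t)\<close> plus the
      Bellman error.\<close>
    unfolding state_barrier_def state_action_barrier_def bellman_error_def by linarith
qed

end
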